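(* Let $m,n$ be positive integers with $m\geq2$ and $n\ge 2$. Then there exists a polynomial $f:\mathbb{R}^{m\times n}\to\mathbb{R}$ of degree four that is SOS polyconvex but not lifted SOS polyconvex.
   Context: Let $N=\sum_{s=1}^{\min(m,n)}\binom{m}{s}\binom{n}{s}$ and let $p:\mathbb{R}^{m\times n}\to\mathbb{R}^N$ map a matrix $X$ to the list (in some fixed order) of all its minors of orders $1,\dots,\min(m,n)$. A polynomial is SOS if it is a finite sum of squares of real polynomials. A polynomial $g:\mathbb{R}^N\to\mathbb{R}$ is SOS convex if $\langle y,\nabla^2 g(x)y\rangle$ is an SOS polynomial in the $2N$ variables $(x,y)$. A polynomial $f:\mathbb{R}^{m\times n}\to\mathbb{R}$ is lifted SOS polyconvex if there is an SOS-convex polynomial $g:\mathbb{R}^N\to\mathbb{R}$ with $f=g\circ p$. It is SOS polyconvex if there is a polynomial map $q:\mathbb{R}^{m\times n}\to\mathbb{R}^N$ such that $f(X)-f(Y)-\langle q(Y),p(X)-p(Y)\rangle$ is an SOS polynomial in the entries of $X$ and $Y$. *)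

theory Defs
  imports "HOL-Analysis.Analysis"
begin

text \<open>
  The space of \<open>m \<times> n\<close> matrices is \<open>real^'n^'m\<close>, with \<open>m = CARD('m)\<close> and
  \<open>n = CARD('n)\<close>.  The index types carry a linear order, which fixes the order of the rows and
  columns of a submatrix and hence the sign of a minor.

  Polynomials on a finite-dimensional real space are identified with the functions they induce
  (\<open>real_polynomial_function\<close>, \<open>polynomial_function\<close>); over the reals nothing is lost.
\<close>

type_synonym ('m, 'n) rmatrix = "((real, 'n) vec, 'm) vec"

text \<open>
  The index type of \<open>\<real>\<^sup>N\<close>: a minor of an \<open>m \<times> n\<close> matrix is given by a nonempty set of rows and a
  set of equally many columns.  Coordinates are labelled by these pairs rather than by
  \<open>1, \<dots>, N\<close>; \<open>card_minor_index\<close> below confirms the value of \<open>N\<close>.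
\<close>

typedef ('m::finite, 'n::finite) minor_index =
  "{(I :: 'm set, J :: 'n set). I \<noteq> {} \<and> card I = card J}"
  by (rule exI[of _ "({undefined}, {undefined})"]) simp

instance minor_index :: (finite, finite) finite
proof
  have "inj Rep_minor_index" by (simp add: inj_def Rep_minor_index_inject)
  then show "finite (UNIV :: ('a, 'b) minor_index set)"
    by (rule finite_imageD[rotated]) (rule finite)
qed

lemma card_minor_index:
  "CARD(('m::finite, 'n::finite) minor_index) =
     (\<Sum>s = 1..min CARD('m) CARD('n). (CARD('m) choose s) * (CARD('n) choose s))"
proof -
  let ?S = "\<lambda>s. {I :: 'm set. card I = s} \<times> {J :: 'n set. card J = s}"
  have eq: "{(I :: 'm set, J :: 'n set). I \<noteq> {} \<and> card I = card J} =
      (\<Union>s\<in>{1..min CARD('m) CARD('n)}. ?S s)"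
  proof (rule set_eqI, clarify)
    fix I :: "'m set" and J :: "'n set"
    have "I \<noteq> {} \<longleftrightarrow> 1 \<le> card I" by (simp add: Suc_le_eq card_gt_0_iff)
    moreover have "card I \<le> CARD('m)" "card J \<le> CARD('n)" by (simp_all add: card_mono)
    ultimately show "(I, J) \<in> {(I, J). I \<noteq> {} \<and> card I = card J} \<longleftrightarrow>
        (I, J) \<in> (\<Union>s\<in>{1..min CARD('m) CARD('n)}. ?S s)"
      by (simp only: mem_Collect_eq case_prod_conv UN_iff mem_Times_iff fst_conv snd_conv
          atLeastAtMost_iff min.bounded_iff Bex_def) metis
  qed
  have "CARD(('m, 'n) minor_index) = card {(I :: 'm set, J :: 'n set). I \<noteq> {} \<and> card I = card J}"
    using type_definition.card[OF type_definition_minor_index] .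
  also have "\<dots> = card (\<Union>s\<in>{1..min CARD('m) CARD('n)}. ?S s)"
    by (simp only: eq)
  also have "\<dots> = (\<Sum>s = 1..min CARD('m) CARD('n). card (?S s))"
    by (intro card_UN_disjoint ballI impI) (fastforce simp: disjoint_iff)+
  also have "\<dots> = (\<Sum>s = 1..min CARD('m) CARD('n). (CARD('m) choose s) * (CARD('n) choose s))"
    using n_subsets[of "UNIV :: 'm set"] n_subsets[of "UNIV :: 'n set"]
    by (simp add: card_cartesian_product)
  finally show ?thesis .
qed

text \<open>
  The Leibniz formula for the determinant of the submatrix of \<open>X\<close> with rows \<open>I\<close> and columns \<open>J\<close>,
  both listed in increasing order.
\<close>

definition minor ::
  "'m::{finite,linorder} set \<Rightarrow> 'n::{finite,linorder} set \<Rightarrow> ('m, 'n) rmatrix \<Rightarrow> real" where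
  "minor I J X =
     (\<Sum>\<sigma> | \<sigma> permutes {..<card I}. of_int (sign \<sigma>) *
        (\<Prod>k<card I. X $ (sorted_list_of_set I ! k) $ (sorted_list_of_set J ! \<sigma> k)))"

lemma minor_singleton: "minor {i} {j} X = X $ i $ j"
  by (simp add: minor_def lessThan_Suc sign_id)

definition minors ::
  "('m::{finite,linorder}, 'n::{finite,linorder}) rmatrix \<Rightarrow> real^('m, 'n) minor_index" where
  "minors X = (\<chi> k. case Rep_minor_index k of (I, J) \<Rightarrow> minor I J X)"

definition sos :: "('a::euclidean_space \<Rightarrow> real) \<Rightarrow> bool" where
  "sos f \<longleftrightarrow> (\<exists>(r::nat) h. (\<forall>i<r. real_polynomial_function (h i)) \<and>
     f = (\<lambda>x. \<Sum>i<r. (h i x)\<^sup>2))"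

definition partial_deriv :: "'k::finite \<Rightarrow> (real^'k \<Rightarrow> real) \<Rightarrow> real^'k \<Rightarrow> real" where
  "partial_deriv i g x = frechet_derivative g (at x) (axis i 1)"

definition hessian :: "(real^'k::finite \<Rightarrow> real) \<Rightarrow> real^'k \<Rightarrow> real^'k^'k" where
  "hessian g x = (\<chi> i j. partial_deriv i (partial_deriv j g) x)"

definition sos_convex :: "(real^'k::finite \<Rightarrow> real) \<Rightarrow> bool" where
  "sos_convex g \<longleftrightarrow> real_polynomial_function g \<and>
     sos (\<lambda>(x, y). y \<bullet> (hessian g x *v y))"

definition lifted_sos_polyconvex ::
  "(('m::{finite,linorder}, 'n::{finite,linorder}) rmatrix \<Rightarrow> real) \<Rightarrow> bool" where
  "lifted_sos_polyconvex f \<longleftrightarrow>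
     (\<exists>g :: real^('m, 'n) minor_index \<Rightarrow> real. sos_convex g \<and> f = g \<circ> minors)"

definition sos_polyconvex ::
  "(('m::{finite,linorder}, 'n::{finite,linorder}) rmatrix \<Rightarrow> real) \<Rightarrow> bool" where
  "sos_polyconvex f \<longleftrightarrow>
     (\<exists>q :: ('m, 'n) rmatrix \<Rightarrow> real^('m, 'n) minor_index. polynomial_function q \<and>
        sos (\<lambda>(X, Y). f X - f Y - q Y \<bullet> (minors X - minors Y)))"

text \<open>
  Here \<open>c\<close> is the family of coefficients of \<open>f\<close>, indexed by exponent matrices \<open>\<alpha>\<close>; it is determined
  by \<open>f\<close>.  The zero polynomial has no degree.
\<close>

definition has_total_degree :: "(('m::finite, 'n::finite) rmatrix \<Rightarrow> real) \<Rightarrow> nat \<Rightarrow> bool" where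
  "has_total_degree f d \<longleftrightarrow>
     (\<exists>c :: ('m \<Rightarrow> 'n \<Rightarrow> nat) \<Rightarrow> real.
        finite {\<alpha>. c \<alpha> \<noteq> 0} \<and> {\<alpha>. c \<alpha> \<noteq> 0} \<noteq> {} \<and>
        f = (\<lambda>X. \<Sum>\<alpha> | c \<alpha> \<noteq> 0. c \<alpha> * (\<Prod>i\<in>UNIV. \<Prod>j\<in>UNIV. X $ i $ j ^ \<alpha> i j)) \<and>
        Max ((\<lambda>\<alpha>. \<Sum>i\<in>UNIV. \<Sum>j\<in>UNIV. \<alpha> i j) ` {\<alpha>. c \<alpha> \<noteq> 0}) = d)"

end

theory Submission
  imports Defs
begin

text \<open>
  On a \<open>2 \<times> 2\<close> block with rows \<open>(a, b)\<close>, \<open>(c, d)\<close> put \<open>z = (a + d, b - c)\<close> and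
  \<open>w = (a - d, b + c)\<close>, so that \<open>\<bar>z\<bar>\<^sup>2 - \<bar>w\<bar>\<^sup>2 = 4 (a d - b c)\<close>, and take
  \<open>f = \<bar>w\<bar>\<^sup>2 (\<bar>w\<bar>\<^sup>2 + \<bar>z\<bar>\<^sup>2)\<close>.  This is, up to a factor, the Alibert--Dacorogna--Marcellini
  function \<open>\<bar>X\<bar>\<^sup>2 (\<bar>X\<bar>\<^sup>2 - 2 \<gamma> det X)\<close> at the threshold \<open>\<gamma> = 1\<close> of polyconvexity; an explicit
  subgradient makes it SOS polyconvex.

  Suppose \<open>f = g \<circ> p\<close> with \<open>g\<close> a convex polynomial.  As \<open>f\<close> vanishes on multiples of the identity,
  \<open>g \<le> 0\<close> on the half-line of nonnegative determinants over the zero matrix, and a convex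
  polynomial that is bounded above on a half-line is affine.  So \<open>g\<close> grows only linearly
  along the whole determinant axis.  Jensen's inequality for \<open>p (diag x x)\<close>, \<open>p (diag y (-y))\<close>
  and a point of this axis, chosen such that the mean is again in the image of \<open>p\<close>, then bounds
  a quartic term of order \<open>x\<^sup>2 y\<^sup>2\<close> by terms of order \<open>y\<^sup>4\<close> and \<open>x\<^sup>2 + y\<^sup>2\<close>, which is absurd for
  \<open>x = 10 y\<close> and large \<open>y\<close>.
\<close>

section \<open>Derivatives of polynomials, and convexity from SOS convexity\<close>

text \<open>Induction over the generation of polynomials. That directional derivatives are again
  polynomials allows a second differentiation, as the Hessian requires.\<close>

lemma real_polynomial_function_has_derivative:
  fixes g :: "'a::real_normed_vector \<Rightarrow> real"
  assumes "real_polynomial_function g"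
  obtains g' where "\<And>x. (g has_derivative g' x) (at x)"
    and "\<And>v. real_polynomial_function (\<lambda>x. g' x v)"
proof -
  have "\<exists>g'. (\<forall>x. (g has_derivative g' x) (at x)) \<and> (\<forall>v. real_polynomial_function (\<lambda>x. g' x v))"
    using assms
  proof (induction g rule: real_polynomial_function.induct)
    case (linear f)
    then show ?case
      by (intro exI[of _ "\<lambda>_. f"]) (auto intro: bounded_linear_imp_has_derivative)
  next
    case (const c)
    show ?case
      by (intro exI[of _ "\<lambda>_ _. 0"]) auto
  next
    case (add f g)
    then obtain f' g' where "\<And>x. (f has_derivative f' x) (at x)" "\<And>x. (g has_derivative g' x) (at x)"
      "\<And>v. real_polynomial_function (\<lambda>x. f' x v)" "\<And>v. real_polynomial_function (\<lambda>x. g' x v)"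
      by blast
    then show ?case
      by (intro exI[of _ "\<lambda>x v. f' x v + g' x v"]) (auto intro: has_derivative_add)
  next
    case (mult f g)
    then obtain f' g' where "\<And>x. (f has_derivative f' x) (at x)" "\<And>x. (g has_derivative g' x) (at x)"
      "\<And>v. real_polynomial_function (\<lambda>x. f' x v)" "\<And>v. real_polynomial_function (\<lambda>x. g' x v)"
      by blast
    with mult.hyps show ?case
      by (intro exI[of _ "\<lambda>x v. f x * g' x v + f' x v * g x"])
        (auto intro!: has_derivative_mult real_polynomial_function.intros(3,4))
  qed
  with that show ?thesis by blast
qed

lemma real_polynomial_function_derivative_along_line:
  fixes g :: "real^'k::finite \<Rightarrow> real"
  assumes "real_polynomial_function g"
  shows "((\<lambda>t. g (x + t *\<^sub>R v)) has_real_derivative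
           (\<Sum>j\<in>UNIV. v $ j * partial_deriv j g (x + t *\<^sub>R v))) (at t)"
    and "real_polynomial_function (partial_deriv j g)"
proof -
  obtain g' where g': "\<And>x. (g has_derivative g' x) (at x)"
    and poly: "\<And>v. real_polynomial_function (\<lambda>x. g' x v)"
    using real_polynomial_function_has_derivative[OF assms] by blast
  have partial: "partial_deriv j g y = g' y (axis j 1)" for j y
    unfolding partial_deriv_def using frechet_derivative_at[OF g'[of y]] by simp
  have "partial_deriv j g = (\<lambda>y. g' y (axis j 1))"
    using partial by blast
  with poly show "real_polynomial_function (partial_deriv j g)"
    by simp
  have expand: "g' y v = (\<Sum>j\<in>UNIV. v $ j * partial_deriv j g y)" for y
  proof -
    interpret linear "g' y"
      using g' has_derivative_linear by blast
    have "g' y v = g' y (\<Sum>j\<in>UNIV. v $ j *\<^sub>R axis j 1)"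
      by (simp add: basis_expansion[of v, unfolded scalar_mult_eq_scaleR])
    then show ?thesis
      by (simp add: sum scaleR partial)
  qed
  have "((\<lambda>t. g (x + t *\<^sub>R v)) has_derivative (\<lambda>h. g' (x + t *\<^sub>R v) (h *\<^sub>R v))) (at t)"
    by (rule has_derivative_compose[of "\<lambda>t. x + t *\<^sub>R v", OF _ g'])
      (auto intro!: derivative_eq_intros)
  moreover have "g' (x + t *\<^sub>R v) (h *\<^sub>R v) = g' (x + t *\<^sub>R v) v * h" for h
    using has_derivative_linear[OF g'] by (simp add: linear_cmul)
  ultimately show "((\<lambda>t. g (x + t *\<^sub>R v)) has_real_derivative
      (\<Sum>j\<in>UNIV. v $ j * partial_deriv j g (x + t *\<^sub>R v))) (at t)"
    by (simp add: has_field_derivative_def expand)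
qed

lemma sos_nonneg: "sos f \<Longrightarrow> f x \<ge> 0"
  by (auto simp: sos_def intro: sum_nonneg)

text \<open>The inequality between \<open>x\<close> and \<open>y\<close> is the one-variable
  inequality between 0 and 1 on the line through \<open>x\<close> in direction
  \<open>y - x\<close>.\<close>

lemma convex_on_UNIV_if_convex_on_lines:
  fixes g :: "'a::real_vector \<Rightarrow> real"
  assumes "\<And>x v. convex_on UNIV (\<lambda>t. g (x + t *\<^sub>R v))"
  shows "convex_on UNIV g"
proof (rule convex_onI)
  fix t :: real and x y :: 'a
  assume "0 < t" "t < 1"
  then have "g (x + ((1 - t) *\<^sub>R 0 + t *\<^sub>R 1) *\<^sub>R (y - x))
      \<le> (1 - t) * g (x + 0 *\<^sub>R (y - x)) + t * g (x + 1 *\<^sub>R (y - x))"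
    by (intro convex_onD[OF assms]) auto
  then show "g ((1 - t) *\<^sub>R x + t *\<^sub>R y) \<le> (1 - t) * g x + t * g y"
    by (simp add: algebra_simps)
qed simp

text \<open>Along a line the second derivative is the Hessian form at
  \<open>(x + t *\<^sub>R v, v)\<close>, a value of an SOS polynomial and hence nonnegative.\<close>

lemma sos_convex_imp_convex:
  assumes "sos_convex g"
  shows "convex_on UNIV g"
proof (rule convex_on_UNIV_if_convex_on_lines)
  fix x v
  have poly: "real_polynomial_function g" and sos: "sos (\<lambda>(x, y). y \<bullet> (hessian g x *v y))"
    using assms by (auto simp: sos_convex_def)
  note D = real_polynomial_function_derivative_along_line
  let ?d = "\<lambda>t. \<Sum>j\<in>UNIV. v $ j * partial_deriv j g (x + t *\<^sub>R v)"
  let ?d2 = "\<lambda>t. \<Sum>j\<in>UNIV. v $ j * (\<Sum>i\<in>UNIV. v $ i * partial_deriv i (partial_deriv j g) (x + t *\<^sub>R v))"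
  show "convex_on UNIV (\<lambda>t. g (x + t *\<^sub>R v))"
  proof (rule f''_ge0_imp_convex[where f' = ?d and f'' = ?d2])
    fix t
    show "(?d has_real_derivative ?d2 t) (at t)"
      by (intro DERIV_sum DERIV_cmult D(1) D(2) poly)
    \<comment> \<open>In \<open>?d2\<close> the outer sum runs over the column index of the Hessian,
      so the two sums are exchanged.\<close>
    have "?d2 t = v \<bullet> (hessian g (x + t *\<^sub>R v) *v v)"
      unfolding inner_vec_def matrix_vector_mult_def hessian_def
      by (simp add: sum_distrib_left mult_ac) (subst sum.swap, simp add: mult.left_commute)
    then show "0 \<le> ?d2 t"
      using sos_nonneg[OF sos, of "(x + t *\<^sub>R v, v)"] by simp
  qed (auto intro: D(1) poly)
qed

section \<open>Convex polynomials on a half-line, and the obstruction to a convex lift\<close>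

text \<open>In degree at least two the bound from above excludes a positive leading coefficient, and
  an affine minorant from convexity excludes a negative one.\<close>

lemma convex_polynomial_bounded_above_imp_affine:
  fixes \<phi> :: "real \<Rightarrow> real"
  assumes poly: "real_polynomial_function \<phi>" and convex: "convex_on UNIV \<phi>"
    and bound: "\<And>x. x \<ge> 0 \<Longrightarrow> \<phi> x \<le> B"
  obtains b where "\<And>x. \<phi> x = \<phi> 0 + b * x"
proof -
  obtain c n where "\<phi> = (\<lambda>x. \<Sum>i\<le>n. c i * x ^ i)"
    using poly real_polynomial_function_imp_sum by blast
  then have "\<phi> x = poly (\<Sum>i\<le>n. monom (c i) i) x" for x
    by (simp add: poly_sum poly_monom)
  then obtain p where p: "\<And>x. \<phi> x = poly p x"
    by blast
  \<comment> \<open>The slope of the secant over [-1, 0]; to the right of 0 a convex function stays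
    above the extension of this secant.\<close>
  define s where "s = \<phi> 0 - \<phi> (-1)"
  have lower: "\<phi> x \<ge> \<phi> 0 + s * x" if "x \<ge> 0" for x
  proof -
    let ?t = "1 / (1 + x)"
    have "\<phi> ((1 - ?t) *\<^sub>R (-1) + ?t *\<^sub>R x) \<le> (1 - ?t) * \<phi> (-1) + ?t * \<phi> x"
      using that by (intro convex_onD[OF convex]) auto
    moreover have "(1 - ?t) *\<^sub>R (-1) + ?t *\<^sub>R x = 0"
      using that by (simp add: field_simps)
    ultimately have "\<phi> 0 \<le> (1 - ?t) * \<phi> (-1) + ?t * \<phi> x"
      by simp
    then have "(1 + x) * \<phi> 0 \<le> (1 + x) * ((1 - ?t) * \<phi> (-1) + ?t * \<phi> x)"
      using that by (intro mult_left_mono) auto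
    also have "\<dots> = ((1 + x) - (1 + x) * ?t) * \<phi> (-1) + (1 + x) * ?t * \<phi> x"
      by (simp only: algebra_simps)
    also have "(1 + x) * ?t = 1"
      using that by simp
    finally show ?thesis
      by (simp add: s_def algebra_simps)
  qed
  have "degree p \<le> 1"
  proof (rule ccontr)
    assume deg: "\<not> degree p \<le> 1"
    then have "lead_coeff p \<noteq> 0"
      by auto
    then consider "lead_coeff p > 0" | "lead_coeff p < 0"
      by linarith
    then show False
    proof cases
      case 1
      let ?q = "p + [:- B:]"
      have "degree ?q = degree p"
        using deg by (intro degree_add_eq_left) simp
      then have lc: "lead_coeff ?q > 0"
        using deg 1 by (cases "degree p") auto
      then obtain N where "\<And>x. x \<ge> N \<Longrightarrow> poly ?q x \<ge> lead_coeff ?q"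
        using poly_pinfty_gt_lc by blast
      from this[of "max N 0"] lc bound[of "max N 0"] show False
        by (simp add: p)
    next
      case 2
      \<comment> \<open>The affine minorant minus \<open>p\<close>: at most 0 for nonnegative
        arguments, although its leading coefficient is positive.\<close>
      let ?q = "- p + [:\<phi> 0, s:]"
      have "degree ?q = degree p"
        using deg by (subst degree_add_eq_left) auto
      moreover have "coeff [:\<phi> 0, s:] (degree p) = 0"
        using deg by (intro coeff_eq_0) auto
      ultimately have lc: "lead_coeff ?q > 0"
        using 2 by simp
      then obtain N where "\<And>x. x \<ge> N \<Longrightarrow> poly ?q x \<ge> lead_coeff ?q"
        using poly_pinfty_gt_lc by blast
      from this[of "max N 0"] lc have "poly ?q (max N 0) > 0"
        by fastforce
      with lower[of "max N 0"] show False
        by (simp add: p algebra_simps)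
    qed
  qed
  then obtain u w where "p = [:u, w:]"
    by (metis One_nat_def degree_pCons_eq degree_eq_zeroE le_Suc_eq le_zero_eq
        nat.inject not_less_eq_eq pCons_cases pCons_0_0 degree_pCons_0 nle_le)
  with p that[of w] show thesis
    by (simp add: algebra_simps)
qed

text \<open>The vectors \<open>u\<close>, \<open>v\<close>, \<open>w\<close> stand for the
  coordinate directions of two diagonal entries and of their 2 x 2 minor; the prescribed value is
  that of the quartic at the diagonal matrix with entries \<open>a\<close>,
  \<open>d\<close>.\<close>

lemma not_convex_polynomial_extension:
  fixes g :: "'a::real_normed_vector \<Rightarrow> real"
  assumes poly: "real_polynomial_function g" and convex: "convex_on UNIV g"
    and g: "\<And>a d. g (a *\<^sub>R u + d *\<^sub>R v + (a * d) *\<^sub>R w) = 2 * (a - d)\<^sup>2 * (a\<^sup>2 + d\<^sup>2)"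
  shows False
proof -
  let ?P = "\<lambda>a d. a *\<^sub>R u + d *\<^sub>R v + (a * d) *\<^sub>R w"
  define \<phi> where "\<phi> = (\<lambda>x. g (x *\<^sub>R w))"
  have "real_polynomial_function (g \<circ> (\<lambda>x. x *\<^sub>R w))"
    using poly by (intro real_polynomial_function_compose polynomial_function_bounded_linear)
      (auto intro: bounded_linear_scaleR_left)
  then have "real_polynomial_function \<phi>"
    by (simp add: \<phi>_def o_def)
  moreover have "convex_on UNIV \<phi>"
  proof (rule convex_onI)
    fix t x y :: real
    assume "0 < t" "t < 1"
    then show "\<phi> ((1 - t) *\<^sub>R x + t *\<^sub>R y) \<le> (1 - t) * \<phi> x + t * \<phi> y"
      using convex_onD[OF convex, of t "x *\<^sub>R w" "y *\<^sub>R w"]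
      by (simp add: \<phi>_def algebra_simps)
  qed simp
  moreover have "\<phi> x \<le> 0" if "x \<ge> 0" for x
  proof -
    \<comment> \<open>\<open>x *\<^sub>R w\<close> is the midpoint of the lifts of
      \<open>sqrt x\<close> and \<open>- sqrt x\<close> times the identity, where \<open>g\<close>
      vanishes.\<close>
    let ?r = "sqrt x"
    have "g ((1 - 1/2) *\<^sub>R ?P ?r ?r + (1/2) *\<^sub>R ?P (-?r) (-?r))
        \<le> (1 - 1/2) * g (?P ?r ?r) + (1/2) * g (?P (-?r) (-?r))"
      by (intro convex_onD[OF convex]) auto
    also have "(1 - 1/2) *\<^sub>R ?P ?r ?r + (1/2) *\<^sub>R ?P (-?r) (-?r) = x *\<^sub>R w"
      using that by (simp add: algebra_simps scaleR_add_left[symmetric])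
    also have "(1 - 1/2) * g (?P ?r ?r) + (1/2) * g (?P (-?r) (-?r)) = 0"
      unfolding g by simp
    finally show ?thesis
      by (simp add: \<phi>_def)
  qed
  ultimately obtain b where b: "\<And>x. \<phi> x = \<phi> 0 + b * x"
    using convex_polynomial_bounded_above_imp_affine by blast
  have \<phi>_0: "\<phi> 0 = 0"
    using g[of 0 0] by (simp add: \<phi>_def)
  \<comment> \<open>The choice of \<open>q\<close> ensures
    \<open>4 * \<bar>b\<bar> \<le> q\<^sup>2\<close>; the ratio 10 makes
    \<open>16/81 * q\<^sup>2 * (p\<^sup>2 + q\<^sup>2)\<close>, the value at the mean, exceed the
    Jensen bound.\<close>
  define q p where "q = \<bar>b\<bar> + 2" and "p = 10 * q"
  \<comment> \<open>\<open>E\<close> solves \<open>(p + q) / 3 * ((p - q) / 3) = (p\<^sup>2 -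
    q\<^sup>2 + E) / 3\<close>, so that the mean of the three points is again a lift. It is
    negative, hence outside the half-line of the bound; affineness gives the value of
    \<open>g\<close> there.\<close>
  define E where "E = - (2/3) * (p\<^sup>2 - q\<^sup>2)"
  let ?M = "?P ((p + q) / 3) ((p - q) / 3)"
  \<comment> \<open>Equal weights 1/3, nested as two binary combinations to fit the two-point
    inequality.\<close>
  have M: "?M = (1 - 1/3) *\<^sub>R ((1 - 1/2) *\<^sub>R ?P p p + (1/2) *\<^sub>R ?P q (-q)) + (1/3) *\<^sub>R (E *\<^sub>R w)"
  proof -
    have "(p + q) / 3 * ((p - q) / 3) = (p * p - q * q + E) / 3"
      by (simp add: E_def field_simps power2_eq_square)
    then show ?thesis
      by (simp add: scaleR_add_right scaleR_add_left scaleR_diff_left scaleR_diff_right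
          add_divide_distrib diff_divide_distrib)
  qed
  have "g ?M \<le> (1 - 1/3) * g ((1 - 1/2) *\<^sub>R ?P p p + (1/2) *\<^sub>R ?P q (-q)) + (1/3) * g (E *\<^sub>R w)"
    unfolding M by (intro convex_onD[OF convex]) auto
  also have "g ((1 - 1/2) *\<^sub>R ?P p p + (1/2) *\<^sub>R ?P q (-q)) \<le> (1 - 1/2) * g (?P p p) + (1/2) * g (?P q (-q))"
    by (intro convex_onD[OF convex]) auto
  finally have "g ?M \<le> 1/3 * g (?P p p) + 1/3 * g (?P q (-q)) + 1/3 * (b * E)"
    using b[of E] \<phi>_0 by (simp add: \<phi>_def add_divide_distrib)
  moreover have "g (?P p p) = 0" "g (?P q (-q)) = 16 * q ^ 4"
    "g ?M = 1616 / 81 * q ^ 4"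
    by (simp_all only: g p_def, simp_all add: field_simps power2_eq_square power4_eq_xxxx)
  moreover have "b * E \<le> 66 * (\<bar>b\<bar> * q\<^sup>2)"
  proof -
    have "b * E = - b * (66 * q\<^sup>2)"
      by (simp add: E_def p_def power2_eq_square)
    also have "\<dots> \<le> \<bar>b\<bar> * (66 * q\<^sup>2)"
      by (intro mult_right_mono) auto
    finally show ?thesis by simp
  qed
  moreover have "4 * (\<bar>b\<bar> * q\<^sup>2) \<le> q\<^sup>2 * q\<^sup>2"
  proof -
    have "4 * \<bar>b\<bar> \<le> q\<^sup>2"
      by (simp add: q_def power2_eq_square algebra_simps)
    then show ?thesis
      using mult_right_mono[of "4 * \<bar>b\<bar>" "q\<^sup>2" "q\<^sup>2"] by simp
  qed
  moreover have "q ^ 4 = q\<^sup>2 * q\<^sup>2" "q\<^sup>2 * q\<^sup>2 > 0"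
    by (auto simp: power2_eq_square power4_eq_xxxx q_def)
  \<comment> \<open>Divided by \<open>q ^ 4\<close>, the estimates would give 1616/81 \<le> (16 +
    66/4) / 3, that is, about 19.95 \<le> 10.83.\<close>
  ultimately show False
    by linarith
qed

section \<open>Homogeneous polynomials and the total degree\<close>

text \<open>Coefficients on \<open>A\<close> may be zero, so sums need no account of cancellation;
  the zero function is homogeneous of every degree.\<close>

definition homogeneous_polynomial :: "nat \<Rightarrow> (('m::finite, 'n::finite) rmatrix \<Rightarrow> real) \<Rightarrow> bool" where
  "homogeneous_polynomial d f \<longleftrightarrow>
     (\<exists>(A :: ('m \<Rightarrow> 'n \<Rightarrow> nat) set) c. finite A \<and> (\<forall>\<alpha>\<in>A. (\<Sum>i\<in>UNIV. \<Sum>j\<in>UNIV. \<alpha> i j) = d) \<and>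
        f = (\<lambda>X. \<Sum>\<alpha>\<in>A. c \<alpha> * (\<Prod>i\<in>UNIV. \<Prod>j\<in>UNIV. X $ i $ j ^ \<alpha> i j)))"

lemma homogeneous_polynomial_const: "homogeneous_polynomial 0 (\<lambda>X. k)"
  unfolding homogeneous_polynomial_def
  by (intro exI[of _ "{\<lambda>_ _. 0}"] exI[of _ "\<lambda>_. k"]) simp

lemma homogeneous_polynomial_entry:
  "homogeneous_polynomial 1 (\<lambda>X :: ('m::finite, 'n::finite) rmatrix. X $ i $ j)"
proof -
  let ?\<alpha> = "\<lambda>i' j'. if i' = i then if j' = j then 1 else 0 else (0 :: nat)"
  have "(\<Sum>j'\<in>UNIV. ?\<alpha> i' j') = (if i' = i then 1 else 0)" for i' :: 'm
    by simp
  then have "(\<Sum>i'\<in>UNIV. \<Sum>j'\<in>UNIV. ?\<alpha> i' j') = 1"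
    by simp
  moreover have "(\<Prod>i'\<in>UNIV. \<Prod>j'\<in>UNIV. X $ i' $ j' ^ ?\<alpha> i' j') = X $ i $ j"
    for X :: "('m, 'n) rmatrix"
  proof -
    have "(\<Prod>j'\<in>UNIV. X $ i' $ j' ^ ?\<alpha> i' j') = (if i' = i then X $ i $ j else 1)" for i'
      by (cases "i' = i") (simp_all add: if_distrib[of "power _"] cong: if_cong)
    then show ?thesis by simp
  qed
  ultimately show ?thesis
    unfolding homogeneous_polynomial_def
    by (intro exI[of _ "{?\<alpha>}"] exI[of _ "\<lambda>_. 1"]) simp
qed

lemma homogeneous_polynomial_add:
  assumes "homogeneous_polynomial d f" "homogeneous_polynomial d g"
  shows "homogeneous_polynomial d (\<lambda>X. f X + g X)"
proof -
  let ?m = "\<lambda>\<alpha> X. \<Prod>i\<in>UNIV. \<Prod>j\<in>UNIV. X $ i $ j ^ \<alpha> i j"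
  obtain A c where A: "finite A" "\<forall>\<alpha>\<in>A. (\<Sum>i\<in>UNIV. \<Sum>j\<in>UNIV. \<alpha> i j) = d"
    and f: "f = (\<lambda>X. \<Sum>\<alpha>\<in>A. c \<alpha> * ?m \<alpha> X)"
    using assms(1) unfolding homogeneous_polynomial_def by blast
  obtain B e where B: "finite B" "\<forall>\<alpha>\<in>B. (\<Sum>i\<in>UNIV. \<Sum>j\<in>UNIV. \<alpha> i j) = d"
    and g: "g = (\<lambda>X. \<Sum>\<alpha>\<in>B. e \<alpha> * ?m \<alpha> X)"
    using assms(2) unfolding homogeneous_polynomial_def by blast
  let ?c = "\<lambda>\<alpha>. (if \<alpha> \<in> A then c \<alpha> else 0) + (if \<alpha> \<in> B then e \<alpha> else 0)"
  have "f X = (\<Sum>\<alpha>\<in>A \<union> B. (if \<alpha> \<in> A then c \<alpha> else 0) * ?m \<alpha> X)" for X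
    unfolding f using A(1) B(1) by (intro sum.mono_neutral_cong_left) auto
  moreover have "g X = (\<Sum>\<alpha>\<in>A \<union> B. (if \<alpha> \<in> B then e \<alpha> else 0) * ?m \<alpha> X)" for X
    unfolding g using A(1) B(1) by (intro sum.mono_neutral_cong_left) auto
  ultimately have "(\<lambda>X. f X + g X) = (\<lambda>X. \<Sum>\<alpha>\<in>A \<union> B. ?c \<alpha> * ?m \<alpha> X)"
    by (simp only: distrib_right sum.distrib)
  with A B show ?thesis
    unfolding homogeneous_polynomial_def by (intro exI[of _ "A \<union> B"] exI[of _ ?c]) auto
qed

lemma homogeneous_polynomial_mult:
  fixes f g :: "('m::finite, 'n::finite) rmatrix \<Rightarrow> real"
  assumes "homogeneous_polynomial d f" "homogeneous_polynomial e g"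
  shows "homogeneous_polynomial (d + e) (\<lambda>X. f X * g X)"
proof -
  let ?m = "\<lambda>(\<alpha> :: 'm \<Rightarrow> 'n \<Rightarrow> nat) X :: ('m, 'n) rmatrix. \<Prod>i\<in>UNIV. \<Prod>j\<in>UNIV. X $ i $ j ^ \<alpha> i j"
  obtain A a where A: "finite A" "\<forall>\<alpha>\<in>A. (\<Sum>i\<in>UNIV. \<Sum>j\<in>UNIV. \<alpha> i j) = d"
    and f: "f = (\<lambda>X. \<Sum>\<alpha>\<in>A. a \<alpha> * ?m \<alpha> X)"
    using assms(1) unfolding homogeneous_polynomial_def by blast
  obtain B b where B: "finite B" "\<forall>\<alpha>\<in>B. (\<Sum>i\<in>UNIV. \<Sum>j\<in>UNIV. \<alpha> i j) = e"
    and g: "g = (\<lambda>X. \<Sum>\<alpha>\<in>B. b \<alpha> * ?m \<alpha> X)"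
    using assms(2) unfolding homogeneous_polynomial_def by blast
  let ?p = "\<lambda>(\<alpha>, \<beta>) i j. \<alpha> i j + \<beta> i j :: nat"
  let ?C = "?p ` (A \<times> B)"
  \<comment> \<open>Different pairs of exponents can have the same sum; the coefficient of \<gamma>
    collects all of them.\<close>
  let ?c = "\<lambda>\<gamma>. \<Sum>x | x \<in> A \<times> B \<and> ?p x = \<gamma>. a (fst x) * b (snd x)"
  have "f X * g X = (\<Sum>\<gamma>\<in>?C. ?c \<gamma> * ?m \<gamma> X)" for X
  proof -
    have "f X * g X = (\<Sum>x\<in>A \<times> B. a (fst x) * b (snd x) * ?m (?p x) X)"
      unfolding f g sum_product sum.cartesian_product
      by (intro sum.cong refl) (auto simp: power_add prod.distrib)
    also have "\<dots> = (\<Sum>\<gamma>\<in>?C. \<Sum>x | x \<in> A \<times> B \<and> ?p x = \<gamma>. a (fst x) * b (snd x) * ?m (?p x) X)"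
      using A(1) B(1) by (intro sum.image_gen) auto
    also have "\<dots> = (\<Sum>\<gamma>\<in>?C. ?c \<gamma> * ?m \<gamma> X)"
      unfolding sum_distrib_right by (intro sum.cong refl) simp
    finally show ?thesis .
  qed
  then have "(\<lambda>X. f X * g X) = (\<lambda>X. \<Sum>\<gamma>\<in>?C. ?c \<gamma> * ?m \<gamma> X)"
    by (rule ext)
  moreover have "\<forall>\<gamma>\<in>?C. (\<Sum>i\<in>UNIV. \<Sum>j\<in>UNIV. \<gamma> i j) = d + e"
    using A(2) B(2) by (auto simp: sum.distrib)
  moreover have "finite ?C"
    using A(1) B(1) by simp
  ultimately show ?thesis
    unfolding homogeneous_polynomial_def by (intro exI[of _ ?C] exI[of _ ?c] conjI)
qed

lemma homogeneous_polynomial_diff: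
  assumes "homogeneous_polynomial d f" "homogeneous_polynomial d g"
  shows "homogeneous_polynomial d (\<lambda>X. f X - g X)"
proof -
  have "homogeneous_polynomial d (\<lambda>X. -1 * g X)"
    using homogeneous_polynomial_mult[OF homogeneous_polynomial_const[of "-1"] assms(2)] by simp
  from homogeneous_polynomial_add[OF assms(1) this] show ?thesis
    by simp
qed

lemma homogeneous_polynomial_power:
  "homogeneous_polynomial d f \<Longrightarrow> homogeneous_polynomial (n * d) (\<lambda>X. f X ^ n)"
  by (induction n) (auto intro: homogeneous_polynomial_const homogeneous_polynomial_mult)

text \<open>Once zero coefficients are removed, the support is nonempty because \<open>f\<close>
  does not vanish at \<open>X\<close>, and every exponent in it has sum \<open>d\<close>.\<close>

lemma homogeneous_polynomial_imp_has_total_degree: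
  assumes "homogeneous_polynomial d f" and "f X \<noteq> 0"
  shows "has_total_degree f d"
proof -
  let ?m = "\<lambda>\<alpha> X. \<Prod>i\<in>UNIV. \<Prod>j\<in>UNIV. X $ i $ j ^ \<alpha> i j"
  obtain A c where A: "finite A" "\<forall>\<alpha>\<in>A. (\<Sum>i\<in>UNIV. \<Sum>j\<in>UNIV. \<alpha> i j) = d"
    and f: "f = (\<lambda>X. \<Sum>\<alpha>\<in>A. c \<alpha> * ?m \<alpha> X)"
    using assms(1) unfolding homogeneous_polynomial_def by blast
  define c' where "c' = (\<lambda>\<alpha>. if \<alpha> \<in> A then c \<alpha> else 0)"
  have supp: "{\<alpha>. c' \<alpha> \<noteq> 0} \<subseteq> A"
    by (auto simp: c'_def)
  then have fin: "finite {\<alpha>. c' \<alpha> \<noteq> 0}"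
    using A(1) finite_subset by blast
  have eq: "f = (\<lambda>X. \<Sum>\<alpha> | c' \<alpha> \<noteq> 0. c' \<alpha> * ?m \<alpha> X)"
    unfolding f using A(1) supp by (intro ext sum.mono_neutral_cong_right) (auto simp: c'_def)
  have nonempty: "{\<alpha>. c' \<alpha> \<noteq> 0} \<noteq> {}"
  proof
    assume "{\<alpha>. c' \<alpha> \<noteq> 0} = {}"
    with assms(2) eq show False
      by (metis (no_types, lifting) sum.empty)
  qed
  have "(\<lambda>\<alpha>. \<Sum>i\<in>UNIV. \<Sum>j\<in>UNIV. \<alpha> i j) ` {\<alpha>. c' \<alpha> \<noteq> 0} = (\<lambda>_. d) ` {\<alpha>. c' \<alpha> \<noteq> 0}"
    using supp A(2) by (intro image_cong refl) blast
  also have "\<dots> = {d}"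
    using nonempty by (simp add: image_constant_conv)
  finally have "Max ((\<lambda>\<alpha>. \<Sum>i\<in>UNIV. \<Sum>j\<in>UNIV. \<alpha> i j) ` {\<alpha>. c' \<alpha> \<noteq> 0}) = d"
    by simp
  with fin nonempty eq show ?thesis
    unfolding has_total_degree_def by blast
qed

section \<open>Minors of a diagonal 2 x 2 block\<close>

lemma minor_eq_0_if_row_eq_0:
  assumes "i \<in> I" "\<And>j. X $ i $ j = 0"
  shows "minor I J X = 0"
proof -
  have "i \<in> set (sorted_list_of_set I)"
    using assms(1) by simp
  then obtain k where "k < card I" "sorted_list_of_set I ! k = i"
    by (metis in_set_conv_nth length_sorted_list_of_set)
  with assms(2) show ?thesis
    unfolding minor_def by (intro sum.neutral ballI) (auto intro!: prod_zero)
qed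

text \<open>As the cardinalities agree, every permutation hits the position of \<open>j\<close>, so
  each Leibniz product has a factor from column \<open>j\<close>.\<close>

lemma minor_eq_0_if_column_eq_0:
  assumes "j \<in> J" "card I = card J" "\<And>i. X $ i $ j = 0"
  shows "minor I J X = 0"
  unfolding minor_def
proof (intro sum.neutral ballI)
  fix \<sigma>
  assume "\<sigma> \<in> {\<sigma>. \<sigma> permutes {..<card I}}"
  then have \<sigma>: "\<sigma> permutes {..<card I}"
    by simp
  have "j \<in> set (sorted_list_of_set J)"
    using assms(1) by simp
  then obtain l where l: "l < card J" "sorted_list_of_set J ! l = j"
    by (metis in_set_conv_nth length_sorted_list_of_set)
  then have "l \<in> \<sigma> ` {..<card I}"
    using permutes_image[OF \<sigma>] assms(2) by simp
  then obtain k where "k < card I" "\<sigma> k = l"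
    by auto
  with l assms(3) show "of_int (sign \<sigma>) *
      (\<Prod>k<card I. X $ (sorted_list_of_set I ! k) $ (sorted_list_of_set J ! \<sigma> k)) = 0"
    by (auto intro!: prod_zero)
qed

lemma minor_doubleton:
  assumes "i1 < i2" "j1 < j2"
  shows "minor {i1, i2} {j1, j2} X = X $ i1 $ j1 * X $ i2 $ j2 - X $ i1 $ j2 * X $ i2 $ j1"
proof -
  have card: "card {i1, i2} = 2"
    using assms by simp
  have lists: "sorted_list_of_set {i1, i2} = [i1, i2]" "sorted_list_of_set {j1, j2} = [j1, j2]"
    using assms by (auto simp: sorted_list_of_set_insert_remove)
  have "{..<2} = {0, Suc 0}"
    by auto
  moreover have "{\<sigma>. \<sigma> permutes {0, Suc 0}} = {id, Transposition.transpose 0 (Suc 0)}"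
    by (auto simp: permutes_doubleton_iff)
  moreover have "id \<noteq> Transposition.transpose 0 (Suc 0)"
    by (metis id_apply transpose_apply_first n_not_Suc_n)
  ultimately show ?thesis
    unfolding minor_def card lists by (simp add: sign_id sign_swap_id)
qed

definition entry_index :: "'m::finite \<Rightarrow> 'n::finite \<Rightarrow> ('m, 'n) minor_index" where
  "entry_index i j = Abs_minor_index ({i}, {j})"

definition block_index :: "'m::finite \<Rightarrow> 'm \<Rightarrow> 'n::finite \<Rightarrow> 'n \<Rightarrow> ('m, 'n) minor_index" where
  "block_index i1 i2 j1 j2 = Abs_minor_index ({i1, i2}, {j1, j2})"

lemma Rep_entry_index: "Rep_minor_index (entry_index i j) = ({i}, {j})"
  unfolding entry_index_def by (subst Abs_minor_index_inverse) auto

lemma Rep_block_index: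
  "i1 \<noteq> i2 \<Longrightarrow> j1 \<noteq> j2 \<Longrightarrow> Rep_minor_index (block_index i1 i2 j1 j2) = ({i1, i2}, {j1, j2})"
  unfolding block_index_def by (subst Abs_minor_index_inverse) auto

lemma minors_entry_index: "minors X $ entry_index i j = X $ i $ j"
  by (simp add: minors_def Rep_entry_index minor_singleton)

lemma minors_block_index:
  assumes "i1 < i2" "j1 < j2"
  shows "minors X $ block_index i1 i2 j1 j2 = X $ i1 $ j1 * X $ i2 $ j2 - X $ i1 $ j2 * X $ i2 $ j1"
  using assms by (simp add: minors_def Rep_block_index minor_doubleton)

definition diag2 :: "'m::finite \<Rightarrow> 'm \<Rightarrow> 'n::finite \<Rightarrow> 'n \<Rightarrow> real \<Rightarrow> real \<Rightarrow> ('m, 'n) rmatrix" where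
  "diag2 i1 i2 j1 j2 a d =
     (\<chi> i j. if i = i1 \<and> j = j1 then a else if i = i2 \<and> j = j2 then d else 0)"

text \<open>Minors using a row or column outside the block vanish; inside it only the two diagonal
  entries and the determinant can be nonzero. This is the shape of the points in
  \<open>not_convex_polynomial_extension\<close>.\<close>

lemma minors_diag2:
  fixes i1 i2 :: "'m::{finite,linorder}" and j1 j2 :: "'n::{finite,linorder}"
  assumes "i1 < i2" "j1 < j2"
  shows "minors (diag2 i1 i2 j1 j2 a d) = a *\<^sub>R axis (entry_index i1 j1) 1 +
    d *\<^sub>R axis (entry_index i2 j2) 1 + (a * d) *\<^sub>R axis (block_index i1 i2 j1 j2) 1"
    (is "minors ?X = ?v")
proof (rule vec_eq_iff[THEN iffD2], rule allI)
  fix k :: "('m, 'n) minor_index"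
  obtain I J where k: "Rep_minor_index k = (I, J)"
    by fastforce
  have IJ: "I \<noteq> {}" "card I = card J"
    using Rep_minor_index[of k] by (auto simp: k)
  have index: "k = l \<longleftrightarrow> (I, J) = Rep_minor_index l" for l
    by (metis Rep_minor_index_inject k)
  have [simp]: "i1 \<noteq> i2" "i2 \<noteq> i1" "j1 \<noteq> j2" "j2 \<noteq> j1"
    using assms by auto
  have v: "?v $ k = a * of_bool (I = {i1} \<and> J = {j1}) + d * of_bool (I = {i2} \<and> J = {j2})
      + a * d * of_bool (I = {i1, i2} \<and> J = {j1, j2})"
    by (auto simp: axis_def index Rep_entry_index Rep_block_index)
  have m: "minors ?X $ k = minor I J ?X"
    by (simp add: minors_def k)
  consider i where "i \<in> I" "i \<notin> {i1, i2}" | j where "j \<in> J" "j \<notin> {j1, j2}"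
    | "I \<subseteq> {i1, i2}" "J \<subseteq> {j1, j2}"
    by blast
  then show "minors ?X $ k = ?v $ k"
  proof cases
    case 1
    moreover from this have "minor I J ?X = 0"
      by (intro minor_eq_0_if_row_eq_0[of i]) (auto simp: diag2_def)
    ultimately show ?thesis
      unfolding m v by auto
  next
    case 2
    moreover from this have "minor I J ?X = 0"
      using IJ by (intro minor_eq_0_if_column_eq_0[of j]) (auto simp: diag2_def)
    ultimately show ?thesis
      unfolding m v by auto
  next
    case 3
    \<comment> \<open>Nonempty sets of equal size inside the block select one of its four entries or
      the whole block.\<close>
    then have "I \<in> Pow {i1, i2}" "J \<in> Pow {j1, j2}"
      by simp_all
    then have "I \<in> {{i1}, {i2}, {i1, i2}}" "J \<in> {{}, {j1}, {j2}, {j1, j2}}"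
      using IJ(1) unfolding Pow_insert Pow_empty by blast+
    then have "(\<exists>i j. I = {i} \<and> J = {j} \<and> i \<in> {i1, i2} \<and> j \<in> {j1, j2}) \<or> I = {i1, i2} \<and> J = {j1, j2}"
      using IJ(2) by (elim insertE) simp_all
    then show ?thesis
      unfolding m v using assms
      by (elim disjE exE conjE) (auto simp: minor_singleton minor_doubleton diag2_def doubleton_eq_iff)
  qed
qed

section \<open>The quartic: its degree, the failure of a lift, and the SOS certificate\<close>

text \<open>Lets a certificate be written as an explicit list of polynomials, with list positions as
  summation indices.\<close>

lemma sos_sum_list:
  assumes "\<And>h. h \<in> set hs \<Longrightarrow> real_polynomial_function h"
  shows "sos (\<lambda>x. \<Sum>h\<leftarrow>hs. (h x)\<^sup>2)"
  unfolding sos_def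
proof (intro exI conjI)
  show "\<forall>i<length hs. real_polynomial_function (hs ! i)"
    using assms by simp
  show "(\<lambda>x. \<Sum>h\<leftarrow>hs. (h x)\<^sup>2) = (\<lambda>x. \<Sum>i<length hs. ((hs ! i) x)\<^sup>2)"
    by (simp add: sum_list_sum_nth atLeast0LessThan)
qed

text \<open>The first factor vanishes exactly if the block is conformal, that is, a multiple of a
  rotation.\<close>

definition conformal_quartic ::
  "'m::finite \<Rightarrow> 'm \<Rightarrow> 'n::finite \<Rightarrow> 'n \<Rightarrow> ('m, 'n) rmatrix \<Rightarrow> real" where
  "conformal_quartic i1 i2 j1 j2 X =
     ((X $ i1 $ j1 - X $ i2 $ j2)\<^sup>2 + (X $ i1 $ j2 + X $ i2 $ j1)\<^sup>2) *
     ((X $ i1 $ j1 - X $ i2 $ j2)\<^sup>2 + (X $ i1 $ j2 + X $ i2 $ j1)\<^sup>2 +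
      ((X $ i1 $ j1 + X $ i2 $ j2)\<^sup>2 + (X $ i1 $ j2 - X $ i2 $ j1)\<^sup>2))"

lemma conformal_quartic_diag2:
  assumes "i1 \<noteq> i2" "j1 \<noteq> j2"
  shows "conformal_quartic i1 i2 j1 j2 (diag2 i1 i2 j1 j2 a d) = 2 * (a - d)\<^sup>2 * (a\<^sup>2 + d\<^sup>2)"
proof -
  have "(a - d)\<^sup>2 + (a + d)\<^sup>2 = 2 * (a\<^sup>2 + d\<^sup>2)"
    by (simp add: power2_eq_square algebra_simps)
  with assms show ?thesis
    by (simp add: conformal_quartic_def diag2_def)
qed

lemma bounded_linear_entry: "bounded_linear (\<lambda>X :: ('m::finite, 'n::finite) rmatrix. X $ i $ j)"
  by (rule bounded_linear_compose[OF bounded_linear_vec_nth bounded_linear_vec_nth])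

lemma real_polynomial_function_entry:
  "real_polynomial_function (\<lambda>X :: ('m::finite, 'n::finite) rmatrix. X $ i $ j)"
  by (intro real_polynomial_function.intros bounded_linear_entry)

lemma real_polynomial_function_conformal_quartic:
  "real_polynomial_function (conformal_quartic i1 i2 j1 j2)"
  unfolding conformal_quartic_def[abs_def]
  by (intro real_polynomial_function.intros(2-4) real_polynomial_function_power
      real_polynomial_function_diff real_polynomial_function_entry)

lemma has_total_degree_conformal_quartic:
  assumes "i1 \<noteq> i2" "j1 \<noteq> j2"
  shows "has_total_degree (conformal_quartic i1 i2 j1 j2) 4"
proof (rule homogeneous_polynomial_imp_has_total_degree)
  note square = homogeneous_polynomial_power[of 1 _ 2, simplified]
  note entry = homogeneous_polynomial_entry[simplified]
  have "homogeneous_polynomial (2 + 2) (conformal_quartic i1 i2 j1 j2)"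
    unfolding conformal_quartic_def[abs_def]
    by (intro homogeneous_polynomial_mult homogeneous_polynomial_add homogeneous_polynomial_diff
        square entry)
  then show "homogeneous_polynomial 4 (conformal_quartic i1 i2 j1 j2)"
    by simp
  show "conformal_quartic i1 i2 j1 j2 (diag2 i1 i2 j1 j2 1 0) \<noteq> 0"
    by (simp add: conformal_quartic_diag2 assms)
qed

text \<open>Restricted to the lifts of diagonal blocks, a function \<open>g\<close> as in the
  definition would be a convex polynomial with the values excluded by
  \<open>not_convex_polynomial_extension\<close>.\<close>

lemma not_lifted_sos_polyconvex_conformal_quartic:
  fixes i1 i2 :: "'m::{finite,linorder}" and j1 j2 :: "'n::{finite,linorder}"
  assumes "i1 < i2" "j1 < j2"
  shows "\<not> lifted_sos_polyconvex (conformal_quartic i1 i2 j1 j2)"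
proof
  assume "lifted_sos_polyconvex (conformal_quartic i1 i2 j1 j2)"
  then obtain g where g: "sos_convex g" and comp: "conformal_quartic i1 i2 j1 j2 = g \<circ> minors"
    unfolding lifted_sos_polyconvex_def by blast
  have "g (minors (diag2 i1 i2 j1 j2 a d)) = 2 * (a - d)\<^sup>2 * (a\<^sup>2 + d\<^sup>2)" for a d
    using conformal_quartic_diag2[of i1 i2 j1 j2 a d] assms by (simp add: comp)
  with g show False
    unfolding minors_diag2[OF assms]
    by (intro not_convex_polynomial_extension[of g] sos_convex_imp_convex)
      (auto simp: sos_convex_def)
qed

text \<open>
  With \<open>r = z1\<^sup>2 + z2\<^sup>2\<close> and \<open>s = w1\<^sup>2 + w2\<^sup>2\<close> the conformal quartic is \<open>s (s + r)\<close>, and \<open>r - s\<close> is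
  four times the block minor.  For \<open>p = z X - z Y\<close>, the certificate is
  \<open>(s X - s Y + z Y \<bullet> p)\<^sup>2 + (\<bar>z Y\<bar>\<^sup>2 \<bar>p\<bar>\<^sup>2 - (z Y \<bullet> p)\<^sup>2) + (s X + 2 s Y) \<bar>p\<bar>\<^sup>2\<close>, where the middle
  term is a square by Lagrange's identity.
\<close>

lemma sos_polyconvex_conformal_quartic:
  fixes i1 i2 :: "'m::{finite,linorder}" and j1 j2 :: "'n::{finite,linorder}"
  assumes "i1 < i2" "j1 < j2"
  shows "sos_polyconvex (conformal_quartic i1 i2 j1 j2)"
proof -
  define z1 z2 w1 w2 :: "('m, 'n) rmatrix \<Rightarrow> real" where
    "z1 = (\<lambda>X. X $ i1 $ j1 + X $ i2 $ j2)" and "z2 = (\<lambda>X. X $ i1 $ j2 - X $ i2 $ j1)" and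
    "w1 = (\<lambda>X. X $ i1 $ j1 - X $ i2 $ j2)" and "w2 = (\<lambda>X. X $ i1 $ j2 + X $ i2 $ j1)"
  note zw_def = z1_def z2_def w1_def w2_def
  define r s where "r = (\<lambda>X. (z1 X)\<^sup>2 + (z2 X)\<^sup>2)" and "s = (\<lambda>X. (w1 X)\<^sup>2 + (w2 X)\<^sup>2)"
  let ?f = "conformal_quartic i1 i2 j1 j2"
  have f: "?f X = s X * (s X + r X)" for X
    by (simp add: conformal_quartic_def r_def s_def zw_def)
  let ?e = "\<lambda>k :: ('m, 'n) minor_index. axis k (1 :: real)"
  \<comment> \<open>With \<open>D\<close> the block minor, \<open>s = r - 4 * D\<close> turns
    \<open>s * (s + r)\<close> into \<open>(r - 4 * D) * (2 * r - 4 * D)\<close>; \<open>q\<close>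
    is the gradient of this expression in the minor coordinates, on which \<open>z1\<close> and
    \<open>z2\<close> depend linearly.\<close>
  define q where "q = (\<lambda>Y.
    ((6 * s Y + 2 * r Y) * z1 Y) *\<^sub>R (?e (entry_index i1 j1) + ?e (entry_index i2 j2)) +
    ((6 * s Y + 2 * r Y) * z2 Y) *\<^sub>R (?e (entry_index i1 j2) - ?e (entry_index i2 j1)) -
    (4 * (2 * s Y + r Y)) *\<^sub>R ?e (block_index i1 i2 j1 j2))"
  note poly_intros = real_polynomial_function.intros(2-4) real_polynomial_function_power
    real_polynomial_function_diff
  have poly: "real_polynomial_function z1" "real_polynomial_function z2"
    "real_polynomial_function w1" "real_polynomial_function w2"
    unfolding zw_def by (intro poly_intros real_polynomial_function_entry)+
  have "polynomial_function q"
    unfolding q_def r_def s_def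
    by (intro polynomial_function_add polynomial_function_diff polynomial_function_mult
        polynomial_function_const; unfold real_polynomial_function_eq[symmetric])
      (intro poly_intros poly)+
  moreover have "sos (\<lambda>(X, Y). ?f X - ?f Y - q Y \<bullet> (minors X - minors Y))"
  proof -
    let ?p1 = "\<lambda>x. z1 (fst x) - z1 (snd x)" and ?p2 = "\<lambda>x. z2 (fst x) - z2 (snd x)"
    let ?hX = "[\<lambda>x. w1 (fst x) * ?p1 x, \<lambda>x. w1 (fst x) * ?p2 x,
      \<lambda>x. w2 (fst x) * ?p1 x, \<lambda>x. w2 (fst x) * ?p2 x]"
    let ?hY = "[\<lambda>x. w1 (snd x) * ?p1 x, \<lambda>x. w1 (snd x) * ?p2 x,
      \<lambda>x. w2 (snd x) * ?p1 x, \<lambda>x. w2 (snd x) * ?p2 x]"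
    \<comment> \<open>The squares of \<open>?hX\<close> and \<open>?hY\<close> sum to
      \<open>s X\<close> and \<open>s Y\<close> times \<open>\<bar>p\<bar>\<^sup>2\<close>;
      \<open>?hY\<close> appears twice for the coefficient 2.\<close>
    define hs where "hs = [\<lambda>x. s (fst x) - s (snd x) + (z1 (snd x) * ?p1 x + z2 (snd x) * ?p2 x),
      \<lambda>x. z1 (snd x) * ?p2 x - z2 (snd x) * ?p1 x] @ ?hX @ ?hY @ ?hY"
    have compose: "real_polynomial_function (\<lambda>x :: ('m, 'n) rmatrix \<times> ('m, 'n) rmatrix. h (fst x))"
      "real_polynomial_function (\<lambda>x :: ('m, 'n) rmatrix \<times> ('m, 'n) rmatrix. h (snd x))"
      if "real_polynomial_function h" for h :: "('m, 'n) rmatrix \<Rightarrow> real"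
      using that real_polynomial_function_compose[of fst h] real_polynomial_function_compose[of snd h]
      by (auto simp: o_def polynomial_function_bounded_linear bounded_linear_fst bounded_linear_snd)
    have "sos (\<lambda>x. \<Sum>h\<leftarrow>hs. (h x)\<^sup>2)"
    proof (rule sos_sum_list)
      fix h
      assume "h \<in> set hs"
      then show "real_polynomial_function h"
        unfolding hs_def s_def
        by (simp only: set_append list.set Un_iff insert_iff empty_iff simp_thms)
          (elim disjE; hypsubst; intro poly_intros compose poly)
    qed
    moreover have "?f X - ?f Y - q Y \<bullet> (minors X - minors Y) = (\<Sum>h\<leftarrow>hs. (h (X, Y))\<^sup>2)" for X Y
    proof -
      \<comment> \<open>Expressing the minor through \<open>r\<close> and \<open>s\<close> leaves an
        identity in the values of \<open>z1\<close>, \<open>z2\<close>, \<open>w1\<close>,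
        \<open>w2\<close> at \<open>X\<close> and \<open>Y\<close> alone.\<close>
      have block: "4 * (minors X - minors Y) $ block_index i1 i2 j1 j2 = (r X - s X) - (r Y - s Y)"
        by (simp add: minors_block_index[OF assms] r_def s_def zw_def power2_eq_square algebra_simps)
      have "q Y \<bullet> (minors X - minors Y) =
          (6 * s Y + 2 * r Y) * (z1 Y * (z1 X - z1 Y) + z2 Y * (z2 X - z2 Y)) -
          (2 * s Y + r Y) * (4 * (minors X - minors Y) $ block_index i1 i2 j1 j2)"
        by (simp add: q_def inner_axis' inner_add_left inner_diff_left minors_entry_index zw_def
            algebra_simps del: vector_minus_component) (simp add: minors_entry_index algebra_simps)
      also have "\<dots> = (6 * s Y + 2 * r Y) * (z1 Y * (z1 X - z1 Y) + z2 Y * (z2 X - z2 Y)) -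
          (2 * s Y + r Y) * ((r X - s X) - (r Y - s Y))"
        unfolding block ..
      finally have "?f X - ?f Y - q Y \<bullet> (minors X - minors Y) =
          s X * (s X + r X) - s Y * (s Y + r Y) -
          (6 * s Y + 2 * r Y) * (z1 Y * (z1 X - z1 Y) + z2 Y * (z2 X - z2 Y)) +
          (2 * s Y + r Y) * ((r X - s X) - (r Y - s Y))"
        by (simp add: f)
      also have "\<dots> = (\<Sum>h\<leftarrow>hs. (h (X, Y))\<^sup>2)"
        by (simp add: hs_def r_def s_def) algebra
      finally show ?thesis .
    qed
    then have "(\<lambda>(X, Y). ?f X - ?f Y - q Y \<bullet> (minors X - minors Y)) = (\<lambda>x. \<Sum>h\<leftarrow>hs. (h x)\<^sup>2)"
      by (simp add: fun_eq_iff)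
    ultimately show ?thesis
      by simp
  qed
  ultimately show ?thesis
    unfolding sos_polyconvex_def by blast
qed

section \<open>Choice of two rows and two columns in a matrix of general size\<close>

lemma exists_less_if_card_ge_2:
  assumes "CARD('a::{finite,linorder}) \<ge> 2"
  obtains x y :: "'a::{finite,linorder}" where "x < y"
proof -
  have "\<not> (\<forall>x y :: 'a. x = y)"
  proof
    assume "\<forall>x y :: 'a. x = y"
    then have "(UNIV :: 'a set) = {undefined}"
      by blast
    with assms show False
      by (metis card.empty card_insert_le_m1 card_1_singleton_iff One_nat_def Suc_1 not_less_eq_eq order_refl)
  qed
  with that show thesis
    by (meson linorder_neqE)
qed

theorem theorem2p5:
  assumes "CARD('m::{finite,linorder}) \<ge> 2" and "CARD('n::{finite,linorder}) \<ge> 2"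
  shows "\<exists>f :: ('m, 'n) rmatrix \<Rightarrow> real.
           real_polynomial_function f \<and> has_total_degree f 4 \<and>
           sos_polyconvex f \<and> \<not> lifted_sos_polyconvex f"
proof -
  obtain i1 i2 :: 'm where i: "i1 < i2"
    using exists_less_if_card_ge_2[OF assms(1)] .
  obtain j1 j2 :: 'n where j: "j1 < j2"
    using exists_less_if_card_ge_2[OF assms(2)] .
  have "has_total_degree (conformal_quartic i1 i2 j1 j2) 4"
    using i j by (intro has_total_degree_conformal_quartic) auto
  with real_polynomial_function_conformal_quartic sos_polyconvex_conformal_quartic[OF i j]
    not_lifted_sos_polyconvex_conformal_quartic[OF i j]
  show ?thesis
    by blast
qed

end
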